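(* Let $X=\mathbb{Z}^{\mathbb{N}}$ and let $G=\mathrm{Hom}(X,\mathbb{Z})$ be the group of all group homomorphisms from $X$ to $\mathbb{Z}$, endowed with the topology of pointwise convergence on $X$. Then $G$ is non-reflexive.
   Context: $\mathbb{Z}$ is the group of integers with the discrete topology. $X=\mathbb{Z}^{\mathbb{N}}$ is the Baer-Specker group, i.e. the group of all functions $\mathbb{N}\to\mathbb{Z}$ under pointwise addition. $\mathrm{Hom}(X,\mathbb{Z})$ consists of all (abstract, not assumed continuous) group homomorphisms $X\to\mathbb{Z}$, with pointwise addition. The topology of pointwise convergence on $G$ is the subspace topology inherited from the Tychonoff product $\mathbb{Z}^{X}$. $\mathbb{T}=\mathbb{R}/\mathbb{Z}$ is the circle group. For an abelian topological group $H$, the (Pontryagin) dual group $\widehat{H}$ is the group of all continuous homomorphisms $H\to\mathbb{T}$ with pointwise addition, equipped with the compact-open topology. An abelian topological group $H$ is called reflexive if its second Pontryagin dual $\widehat{\widehat{H}}$ is topologically isomorphic to $H$; it is non-reflexive otherwise. *)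

theory Defs
  imports "HOL-Analysis.Analysis" "HOL-Algebra.Coset" "HOL-Algebra.Product_Groups"
begin

section \<open>Abelian topological groups\<close>

record 'a top_group = "'a monoid" +
  group_topology :: "'a topology"

locale abelian_topological_group = comm_group G
  for G :: "('a, 'b) top_group_scheme" (structure) +
  assumes topspace_group: "topspace (group_topology G) = carrier G"
    and continuous_mult:
      "continuous_map (prod_topology (group_topology G) (group_topology G)) (group_topology G)
         (\<lambda>(x, y). x \<otimes> y)"
    and continuous_inv: "continuous_map (group_topology G) (group_topology G) (\<lambda>x. inv x)"

definition topologically_isomorphic ::
    "('a, 'c) top_group_scheme \<Rightarrow> ('b, 'd) top_group_scheme \<Rightarrow> bool" where
  "topologically_isomorphic G H \<longleftrightarrow>
     (\<exists>\<phi>\<in>iso G H. homeomorphic_map (group_topology G) (group_topology H) \<phi>)"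

section \<open>The circle group\<close>

definition real_group :: "real monoid" where
  "real_group = \<lparr>carrier = UNIV, monoid.mult = (+), one = 0\<rparr>"

text \<open>The elements of the circle group are the cosets of the integers in the reals; its topology is
  the quotient topology, see \<open>quotient_map_circle\<close> below.\<close>

definition circle_topology :: "real set topology" where
  "circle_topology = topology (\<lambda>U. U \<subseteq> carrier (real_group Mod \<int>) \<and> open {x. \<int> #>\<^bsub>real_group\<^esub> x \<in> U})"

definition circle_group :: "real set top_group" where
  "circle_group =
     \<lparr>carrier = carrier (real_group Mod \<int>),
      monoid.mult = monoid.mult (real_group Mod \<int>),
      one = one (real_group Mod \<int>),
      group_topology = circle_topology\<rparr>"

lemma openin_circle_topology:
  "openin circle_topology U \<longleftrightarrow>
     U \<subseteq> carrier (real_group Mod \<int>) \<and> open {x. \<int> #>\<^bsub>real_group\<^esub> x \<in> U}"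
proof -
  have "istopology (\<lambda>U. U \<subseteq> carrier (real_group Mod \<int>) \<and> open {x. \<int> #>\<^bsub>real_group\<^esub> x \<in> U})"
    (is "istopology ?L")
    unfolding istopology_def
  proof (intro conjI allI impI)
    fix S T assume "?L S" "?L T"
    then show "S \<inter> T \<subseteq> carrier (real_group Mod \<int>)" "open {x. \<int> #>\<^bsub>real_group\<^esub> x \<in> S \<inter> T}"
      by (auto simp: open_Collect_conj)
  next
    fix \<K> assume K: "\<forall>K\<in>\<K>. ?L K"
    then show "\<Union>\<K> \<subseteq> carrier (real_group Mod \<int>)" by blast
    have "{x. \<int> #>\<^bsub>real_group\<^esub> x \<in> \<Union>\<K>} = (\<Union>K\<in>\<K>. {x. \<int> #>\<^bsub>real_group\<^esub> x \<in> K})"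
      by blast
    then show "open {x. \<int> #>\<^bsub>real_group\<^esub> x \<in> \<Union>\<K>}"
      using K by auto
  qed
  then show ?thesis
    by (simp add: circle_topology_def)
qed

lemma carrier_real_group [simp]: "carrier real_group = UNIV"
  and mult_real_group [simp]: "x \<otimes>\<^bsub>real_group\<^esub> y = x + y"
  and one_real_group [simp]: "\<one>\<^bsub>real_group\<^esub> = 0"
  by (simp_all add: real_group_def)

lemma comm_group_real_group: "comm_group real_group"
  by (rule comm_groupI) (auto intro: exI [of _ "- x" for x])

lemma topspace_circle_topology [simp]:
  "topspace circle_topology = carrier (real_group Mod \<int>)"
proof -
  have "openin circle_topology (carrier (real_group Mod \<int>))"
    by (auto simp: openin_circle_topology carrier_FactGroup)
  then show ?thesis
    by (metis openin_circle_topology openin_subset openin_topspace subset_antisym)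
qed

lemma quotient_map_circle:
  "quotient_map euclidean circle_topology (\<lambda>x. \<int> #>\<^bsub>real_group\<^esub> x)"
  by (auto simp: quotient_map_def openin_circle_topology carrier_FactGroup)

lemma inv_real_group [simp]: "inv\<^bsub>real_group\<^esub> x = - x"
  using comm_group.axioms(2) comm_group_real_group group.inv_equality by fastforce

lemma normal_Ints: "\<int> \<lhd> real_group"
proof -
  interpret comm_group real_group by (rule comm_group_real_group)
  have "subgroup \<int> real_group"
    by unfold_locales auto
  then show ?thesis
    by (rule subgroup_imp_normal)
qed

lemma abelian_topological_group_circle: "abelian_topological_group circle_group"
proof -
  let ?q = "\<lambda>x. \<int> #>\<^bsub>real_group\<^esub> x"
  interpret R: comm_group real_group by (rule comm_group_real_group)
  interpret N: normal "\<int>" real_group by (rule normal_Ints)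
  interpret Q: comm_group "real_group Mod \<int>"
    by (rule R.abelian_FactGroup) (rule N.subgroup_axioms)
  have comm: "comm_group circle_group"
    by (rule comm_groupI; simp add: circle_group_def del: mult_FactGroup one_FactGroup)
      (erule (2) Q.m_assoc | erule (1) Q.m_comm | erule Q.l_inv_ex)+
  then interpret C: comm_group circle_group .
  have carr: "carrier circle_group = range ?q"
    by (simp add: circle_group_def carrier_FactGroup)
  have top: "group_topology circle_group = circle_topology"
    by (simp add: circle_group_def)
  have mult: "?q x \<otimes>\<^bsub>circle_group\<^esub> ?q y = ?q (x + y)" for x y
    using N.rcos_sum [of x y] by (simp add: circle_group_def)
  have one: "\<one>\<^bsub>circle_group\<^esub> = ?q 0"
    using N.subset R.coset_mult_one by (simp add: circle_group_def)
  have inv: "inv\<^bsub>circle_group\<^esub> (?q x) = ?q (- x)" for x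
    by (rule C.inv_equality) (auto simp: mult one carr)
  have qeq: "?q x = ?q y \<longleftrightarrow> x - y \<in> \<int>" for x y
  proof -
    have mem: "u \<in> ?q v \<longleftrightarrow> u - v \<in> \<int>" for u v
      by (auto simp: r_coset_def intro: bexI [of _ "u - v"])
    show ?thesis
    proof
      assume "?q x = ?q y"
      moreover have "x \<in> ?q x" by (simp add: mem)
      ultimately have "x \<in> ?q y" by simp
      then show "x - y \<in> \<int>" by (simp add: mem)
    next
      assume "x - y \<in> \<int>"
      then have "x \<in> ?q y" by (simp add: mem)
      then show "?q x = ?q y"
        using R.repr_independence [of x \<int> y] N.subgroup_axioms by simp
    qed
  qed
  have cq: "continuous_map euclidean circle_topology ?q"
    by (rule quotient_imp_continuous_map) (rule quotient_map_circle)
  have oq: "open_map euclidean circle_topology ?q"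
    unfolding open_map_def
  proof (intro allI impI)
    fix V :: "real set" assume "openin euclidean V"
    then have V: "open V" by simp
    have "{x. ?q x \<in> ?q ` V} = (\<Union>n\<in>\<int>. (+) n ` V)"
    proof (intro equalityI subsetI)
      fix x assume "x \<in> {x. ?q x \<in> ?q ` V}"
      then obtain v where "v \<in> V" "x - v \<in> \<int>" by (auto simp: qeq)
      then show "x \<in> (\<Union>n\<in>\<int>. (+) n ` V)"
        by (intro UN_I [of "x - v"]) (auto intro: image_eqI [of _ _ v])
    next
      fix x assume "x \<in> (\<Union>n\<in>\<int>. (+) n ` V)"
      then obtain n v where "n \<in> \<int>" "v \<in> V" "x = n + v" by auto
      then show "x \<in> {x. ?q x \<in> ?q ` V}"
        using qeq [of x v] by auto
    qed
    moreover have "open (\<Union>n\<in>\<int>. (+) n ` V)"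
      using V by (intro open_UN ballI open_translation)
    ultimately show "openin circle_topology (?q ` V)"
      by (auto simp: openin_circle_topology carrier_FactGroup)
  qed
  have qq: "quotient_map (prod_topology euclidean euclidean) (prod_topology circle_topology circle_topology)
      (\<lambda>(x, y). (?q x, ?q y))"
  proof (rule continuous_open_imp_quotient_map)
    show "continuous_map (prod_topology euclidean euclidean) (prod_topology circle_topology circle_topology)
        (\<lambda>(x, y). (?q x, ?q y))"
      using cq by (subst continuous_map_prod_top) blast
    show "open_map (prod_topology euclidean euclidean) (prod_topology circle_topology circle_topology)
        (\<lambda>(x, y). (?q x, ?q y))"
      unfolding open_map_def
    proof (intro allI impI)
      fix W :: "(real \<times> real) set"
      assume W: "openin (prod_topology euclidean euclidean) W"
      show "openin (prod_topology circle_topology circle_topology) ((\<lambda>(x, y). (?q x, ?q y)) ` W)"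
        unfolding openin_prod_topology_alt
      proof (intro allI impI)
        fix a b assume "(a, b) \<in> (\<lambda>(x, y). (?q x, ?q y)) ` W"
        then obtain x y where "(x, y) \<in> W" and ab: "a = ?q x" "b = ?q y" by auto
        then obtain U V where UV: "openin euclidean U" "openin euclidean V" "x \<in> U" "y \<in> V" "U \<times> V \<subseteq> W"
          using W unfolding openin_prod_topology_alt by meson
        have "?q ` U \<times> ?q ` V \<subseteq> (\<lambda>(x, y). (?q x, ?q y)) ` W"
          using UV(5) by force
        moreover have "openin circle_topology (?q ` U)" "openin circle_topology (?q ` V)"
          using oq UV(1,2) by (auto simp: open_map_def)
        ultimately show "\<exists>U V. openin circle_topology U \<and> openin circle_topology V \<and> a \<in> U \<and> b \<in> V \<and>
            U \<times> V \<subseteq> (\<lambda>(x, y). (?q x, ?q y)) ` W"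
          using UV(3,4) ab by blast
      qed
    qed
    show "(\<lambda>(x, y). (?q x, ?q y)) ` topspace (prod_topology euclidean euclidean) =
        topspace (prod_topology circle_topology circle_topology)"
      by (auto simp: carrier_FactGroup image_iff)
  qed
  show ?thesis
  proof (intro abelian_topological_group.intro abelian_topological_group_axioms.intro comm)
    show "topspace (group_topology circle_group) = carrier circle_group"
      by (simp add: circle_group_def)
    have "continuous_map (prod_topology euclidean euclidean) circle_topology
        ((\<lambda>(x, y). x \<otimes>\<^bsub>circle_group\<^esub> y) \<circ> (\<lambda>(x, y). (?q x, ?q y)))"
    proof -
      have "continuous_map (prod_topology euclidean euclidean) euclidean (\<lambda>p::real \<times> real. fst p + snd p)"
        by (auto simp: prod_topology_euclidean intro!: continuous_intros)
      from continuous_map_compose [OF this cq]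
      show ?thesis
        by (simp add: o_def case_prod_unfold mult)
    qed
    then show "continuous_map (prod_topology (group_topology circle_group) (group_topology circle_group))
        (group_topology circle_group) (\<lambda>(x, y). x \<otimes>\<^bsub>circle_group\<^esub> y)"
      unfolding top by (rule iffD1 [OF continuous_compose_quotient_map_eq [OF qq]])
    have "continuous_map euclidean circle_topology ((\<lambda>x. inv\<^bsub>circle_group\<^esub> x) \<circ> ?q)"
    proof -
      have "continuous_map euclidean euclidean (\<lambda>x::real. - x)"
        by (auto intro!: continuous_intros)
      from continuous_map_compose [OF this cq]
      show ?thesis
        by (simp add: o_def inv)
    qed
    then show "continuous_map (group_topology circle_group) (group_topology circle_group)
        (\<lambda>x. inv\<^bsub>circle_group\<^esub> x)"
      unfolding top by (rule iffD1 [OF continuous_compose_quotient_map_eq [OF quotient_map_circle]])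
  qed
qed

section \<open>Pontryagin duality\<close>

text \<open>Characters are taken to be \<^const>\<open>extensional\<close>, so that a character is determined by its values
  on the carrier.\<close>

definition characters :: "('a, 'b) top_group_scheme \<Rightarrow> ('a \<Rightarrow> real set) set" where
  "characters H =
     {\<alpha> \<in> hom H circle_group \<inter> extensional (carrier H).
        continuous_map (group_topology H) (group_topology circle_group) \<alpha>}"

definition compact_open_topology :: "('a, 'b) top_group_scheme \<Rightarrow> ('a \<Rightarrow> real set) topology" where
  "compact_open_topology H =
     topology_generated_by
       {{\<alpha> \<in> characters H. \<alpha> ` K \<subseteq> U} | K U.
          compactin (group_topology H) K \<and> openin (group_topology circle_group) U}"

definition dual_group :: "('a, 'b) top_group_scheme \<Rightarrow> ('a \<Rightarrow> real set) top_group" where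
  "dual_group H =
     \<lparr>carrier = characters H,
      monoid.mult = (\<lambda>\<alpha> \<beta>. \<lambda>x\<in>carrier H. \<alpha> x \<otimes>\<^bsub>circle_group\<^esub> \<beta> x),
      one = (\<lambda>x\<in>carrier H. \<one>\<^bsub>circle_group\<^esub>),
      group_topology = compact_open_topology H\<rparr>"

text \<open>Reflexivity asks for \<^emph>\<open>some\<close> topological isomorphism onto the second dual, not necessarily for
  the canonical evaluation map to be one.\<close>

definition pontryagin_reflexive :: "('a, 'b) top_group_scheme \<Rightarrow> bool" where
  "pontryagin_reflexive H \<longleftrightarrow> topologically_isomorphic (dual_group (dual_group H)) H"

lemma topspace_compact_open_topology [simp]:
  "topspace (compact_open_topology H) = characters H"
proof -
  have "characters H \<in> {{\<alpha> \<in> characters H. \<alpha> ` K \<subseteq> U} | K U.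
          compactin (group_topology H) K \<and> openin (group_topology circle_group) U}"
    by (rule CollectI, rule exI [of _ "{}"], rule exI [of _ "{}"]) auto
  then show ?thesis
    unfolding compact_open_topology_def by auto
qed

section \<open>The Baer-Specker group and its group of integer-valued homomorphisms\<close>

definition baer_specker :: "(nat \<Rightarrow> int) monoid" where
  "baer_specker = product_group UNIV (\<lambda>_. integer_group)"

definition Hom_baer_specker :: "((nat \<Rightarrow> int) \<Rightarrow> int) top_group" where
  "Hom_baer_specker =
     \<lparr>carrier = hom baer_specker integer_group,
      monoid.mult = (\<lambda>f g x. f x + g x),
      one = (\<lambda>x. 0),
      group_topology =
        subtopology (product_topology (\<lambda>_. discrete_topology UNIV) (carrier baer_specker))
          (hom baer_specker integer_group)\<rparr>"

lemma carrier_baer_specker [simp]: "carrier baer_specker = UNIV"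
  and mult_baer_specker [simp]: "x \<otimes>\<^bsub>baer_specker\<^esub> y = (\<lambda>n. x n + y n)"
  and one_baer_specker [simp]: "\<one>\<^bsub>baer_specker\<^esub> = (\<lambda>n. 0)"
  by (auto simp: baer_specker_def)

lemma abelian_topological_group_Hom_baer_specker:
  "abelian_topological_group Hom_baer_specker"
proof -
  let ?P = "product_topology (\<lambda>_::nat \<Rightarrow> int. discrete_topology (UNIV :: int set)) UNIV"
  let ?H = "hom baer_specker integer_group"
  have top: "group_topology Hom_baer_specker = subtopology ?P ?H"
    and carr: "carrier Hom_baer_specker = ?H"
    and mult: "f \<otimes>\<^bsub>Hom_baer_specker\<^esub> g = (\<lambda>x. f x + g x)"
    and one: "\<one>\<^bsub>Hom_baer_specker\<^esub> = (\<lambda>x. 0)" for f g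
    by (simp_all add: Hom_baer_specker_def)
  have H: "f \<in> ?H \<longleftrightarrow> (\<forall>x y. f (\<lambda>n. x n + y n) = f x + f y)" for f
    by (auto simp: hom_def)
  have um: "(\<lambda>x. - f x) \<in> ?H" if "f \<in> ?H" for f
    using that by (simp add: H)
  have comm: "comm_group Hom_baer_specker"
  proof (rule comm_groupI)
    fix f assume "f \<in> carrier Hom_baer_specker"
    then show "\<exists>g\<in>carrier Hom_baer_specker. g \<otimes>\<^bsub>Hom_baer_specker\<^esub> f = \<one>\<^bsub>Hom_baer_specker\<^esub>"
      by (intro bexI [of _ "\<lambda>x. - f x"]) (auto simp: carr mult one um)
  qed (auto simp: carr mult one H algebra_simps)
  then interpret comm_group Hom_baer_specker .
  have inv: "inv\<^bsub>Hom_baer_specker\<^esub> f = (\<lambda>x. - f x)" if "f \<in> ?H" for f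
    by (rule inv_equality) (use that um in \<open>auto simp: carr mult one\<close>)
  have proj: "continuous_map (subtopology ?P ?H) (discrete_topology UNIV) (\<lambda>f. f x)" for x
    by (intro continuous_map_from_subtopology continuous_map_product_projection) simp
  show ?thesis
  proof (intro abelian_topological_group.intro abelian_topological_group_axioms.intro comm)
    show "topspace (group_topology Hom_baer_specker) = carrier Hom_baer_specker"
      by (simp add: top carr)
    let ?D = "discrete_topology (UNIV :: int set)"
    let ?S = "subtopology ?P ?H"
    have "continuous_map (prod_topology ?S ?S) ?D (\<lambda>p. fst p x + snd p x)" for x
    proof -
      have 1: "continuous_map (prod_topology ?S ?S) (prod_topology ?D ?D) (\<lambda>p. (fst p x, snd p x))"
        by (intro continuous_map_pairedI continuous_map_compose [OF continuous_map_fst proj, unfolded o_def]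
            continuous_map_compose [OF continuous_map_snd proj, unfolded o_def])
      have 2: "continuous_map (prod_topology ?D ?D) ?D (\<lambda>p. fst p + snd p)"
        by (simp flip: prod_topology_discrete_topology)
      show ?thesis
        using continuous_map_compose [OF 1 2] by (simp add: o_def)
    qed
    then show "continuous_map
        (prod_topology (group_topology Hom_baer_specker) (group_topology Hom_baer_specker))
        (group_topology Hom_baer_specker) (\<lambda>(f, g). f \<otimes>\<^bsub>Hom_baer_specker\<^esub> g)"
      by (auto simp: top mult case_prod_unfold continuous_map_in_subtopology
          continuous_map_componentwise_UNIV H)
    have "continuous_map ?S ?D (\<lambda>f. - f x)" for x
      using continuous_map_compose [OF proj, of ?D "uminus" x] by (simp add: o_def)
    then have "continuous_map ?S ?S (\<lambda>f x. - f x)"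
      by (auto simp: continuous_map_in_subtopology continuous_map_componentwise_UNIV um)
    then show "continuous_map (group_topology Hom_baer_specker) (group_topology Hom_baer_specker)
        (\<lambda>f. inv\<^bsub>Hom_baer_specker\<^esub> f)"
      unfolding top by (rule continuous_map_eq) (simp add: inv)
  qed
qed

end

theory Submission
  imports Defs
begin

text \<open>Write \<open>G\<close> for \<^const>\<open>Hom_baer_specker\<close>. The second dual is discrete while \<open>G\<close> is not, so no
  homeomorphism between them exists. By Specker's theorem each element of \<open>G\<close> has finite
  support, and a gliding hump argument makes the support uniform on compact subsets of \<open>G\<close>. So the
  circles of characters \<open>f \<mapsto> t f(e\<^sub>n)\<close>, \<open>t \<in> \<real>\<close>, shrink to the trivial character as \<open>n\<close> grows,
  and their union is compact in the dual. A character of the dual that maps this union into a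
  small arc is trivial on every circle, because the arc contains no nontrivial subgroup. The circles
  generate a dense subgroup, so the character is trivial. In \<open>G\<close>, on the other hand, finitely many
  points of \<open>\<int>\<^sup>\<nat>\<close> always have a common nonzero annihilator.\<close>

section \<open>Homomorphisms from the Baer-Specker group to the integers; Specker's theorem\<close>

definition delta :: "nat \<Rightarrow> nat \<Rightarrow> int" where
  "delta n = (\<lambda>i. if i = n then 1 else 0)"

abbreviation Hom_bs :: "((nat \<Rightarrow> int) \<Rightarrow> int) set" where
  "Hom_bs \<equiv> hom baer_specker integer_group"

lemma mem_Hom: "f \<in> Hom_bs \<longleftrightarrow> (\<forall>x y. f (\<lambda>n. x n + y n) = f x + f y)"
  by (auto simp: hom_def)

lemma Hom_add: "f \<in> Hom_bs \<Longrightarrow> f (\<lambda>n. x n + y n) = f x + f y"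
  by (simp add: mem_Hom)

lemma Hom_zero: "f \<in> Hom_bs \<Longrightarrow> f (\<lambda>n. 0) = 0"
  using Hom_add [of f "\<lambda>n. 0" "\<lambda>n. 0"] by simp

lemma Hom_minus:
  assumes "f \<in> Hom_bs" shows "f (\<lambda>n. - x n) = - f x"
  using Hom_add [OF assms, of x "\<lambda>n. - x n"] Hom_zero [OF assms] by simp

lemma Hom_scale:
  assumes f: "f \<in> Hom_bs" shows "f (\<lambda>n. k * x n) = k * f x"
proof -
  have *: "f (\<lambda>n. int j * x n) = int j * f x" for j
  proof (induction j)
    case 0 then show ?case by (simp add: Hom_zero [OF f])
  next
    case (Suc j)
    then show ?case using Hom_add [OF f, of x "\<lambda>n. int j * x n"] by (simp add: algebra_simps)
  qed
  show ?thesis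
    using *[of "nat k"] *[of "nat (- k)"] Hom_minus [OF f, of "\<lambda>n. k * x n"]
    by (cases "k \<ge> 0") auto
qed

lemma Hom_initial_segment:
  assumes f: "f \<in> Hom_bs"
  shows "f (\<lambda>i. if i < m then x i else 0) = (\<Sum>i<m. x i * f (delta i))"
proof (induction m)
  case 0 then show ?case by (simp add: Hom_zero [OF f])
next
  case (Suc m)
  have "(\<lambda>i. if i < Suc m then x i else 0) = (\<lambda>i. (if i < m then x i else 0) + x m * delta m i)"
    by (auto simp: delta_def less_Suc_eq)
  then show ?case
    using Hom_add [OF f, of "\<lambda>i. if i < m then x i else 0" "\<lambda>i. x m * delta m i"]
      Hom_scale [OF f, of "x m" "delta m"] Suc by simp
qed

lemma Hom_proj: "(\<lambda>x. x n) \<in> Hom_bs"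
  by (simp add: mem_Hom)

text \<open>Cutting off the first \<open>m\<close> terms does not change the value, and what remains
  is \<open>p ^ m\<close> times a sequence. So the value is divisible by every power of
  \<open>p\<close>, which only 0 is.\<close>

lemma Hom_eventually_divisible:
  assumes f: "f \<in> Hom_bs" and 0: "\<And>n. f (delta n) = 0" and p: "\<bar>p\<bar> > 1"
  shows "f (\<lambda>n. p ^ n * u n) = 0"
proof (rule ccontr)
  let ?a = "f (\<lambda>n. p ^ n * u n)"
  assume nz: "?a \<noteq> 0"
  have dvd: "p ^ m dvd ?a" for m
  proof -
    have "(\<lambda>n. p ^ n * u n) = (\<lambda>n. (if n < m then p ^ n * u n else 0) +
        p ^ m * (if n < m then 0 else p ^ (n - m) * u n))"
      by (auto simp: fun_eq_iff power_add [symmetric] mult.assoc [symmetric])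
    then have "?a = f (\<lambda>n. if n < m then p ^ n * u n else 0) +
        p ^ m * f (\<lambda>n. if n < m then 0 else p ^ (n - m) * u n)"
      by (simp only: Hom_add [OF f] Hom_scale [OF f])
    then show ?thesis
      using Hom_initial_segment [OF f, of m "\<lambda>n. p ^ n * u n"] by (simp add: 0)
  qed
  have "\<bar>p\<bar> ^ m \<le> \<bar>?a\<bar>" for m
    using dvd_imp_le_int [OF nz dvd [of m]] by (simp add: power_abs)
  moreover have "int m < \<bar>p\<bar> ^ m" for m
  proof -
    have "int m < 2 ^ m" by (metis of_nat_less_two_power)
    also have "\<dots> \<le> \<bar>p\<bar> ^ m" using p by (intro power_mono) auto
    finally show ?thesis .
  qed
  ultimately have "int m < \<bar>?a\<bar>" for m by (meson less_le_trans)
  from this [of "nat \<bar>?a\<bar>"] show False by simp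
qed

text \<open>Since \<open>2 ^ n\<close> and \<open>3 ^ n\<close> are coprime, every sequence is a sum of one with \<open>n\<close>-th term divisible
  by \<open>2 ^ n\<close> and one with \<open>n\<close>-th term divisible by \<open>3 ^ n\<close>.\<close>

lemma Hom_eq_zero:
  assumes f: "f \<in> Hom_bs" and 0: "\<And>n. f (delta n) = 0"
  shows "f x = 0"
proof -
  have "\<exists>u v. x n = 2 ^ n * u + 3 ^ n * v" for n
  proof -
    have "coprime (2 ^ n :: int) (3 ^ n)" by simp
    then obtain u v where "u * 2 ^ n + v * 3 ^ n = (1 :: int)"
      using bezout_int [of "2 ^ n" "3 ^ n"] by auto
    then have "x n = (u * 2 ^ n + v * 3 ^ n) * x n" by simp
    also have "\<dots> = 2 ^ n * (u * x n) + 3 ^ n * (v * x n)" by (simp only: algebra_simps)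
    finally show ?thesis by blast
  qed
  then obtain u v where "\<And>n. x n = 2 ^ n * u n + 3 ^ n * v n" by metis
  then have "x = (\<lambda>n. 2 ^ n * u n + 3 ^ n * v n)" by blast
  then have "f x = f (\<lambda>n. 2 ^ n * u n) + f (\<lambda>n. 3 ^ n * v n)"
    by (simp only: Hom_add [OF f])
  then show ?thesis
    using Hom_eventually_divisible [OF f 0] by simp
qed

text \<open>Erasing the first \<open>m\<close> coordinates of the argument before applying
  \<open>f\<close> gives a homomorphism \<open>?g\<close> that kills every \<open>delta n\<close>,
  hence vanishes by \<open>Hom_eq_zero\<close>. Only the initial segment contributes.\<close>

lemma Hom_finite_support:
  assumes f: "f \<in> Hom_bs" and 0: "\<And>i. m \<le> i \<Longrightarrow> f (delta i) = 0"
  shows "f x = (\<Sum>i<m. x i * f (delta i))"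
proof -
  let ?g = "\<lambda>x. f (\<lambda>i. if i < m then 0 else x i)"
  have g: "?g \<in> Hom_bs"
  proof -
    have "(\<lambda>i. if i < m then 0 else x i + y i) =
        (\<lambda>i. (if i < m then 0 else x i) + (if i < m then 0 else y i))" for x y :: "nat \<Rightarrow> int"
      by auto
    then show ?thesis by (simp add: mem_Hom Hom_add [OF f])
  qed
  have "?g (delta n) = 0" for n
  proof (cases "n < m")
    case True
    then have "(\<lambda>i. if i < m then 0 else delta n i) = (\<lambda>i. 0)" by (auto simp: delta_def)
    then show ?thesis by (simp add: Hom_zero [OF f])
  next
    case False
    then have "(\<lambda>i. if i < m then 0 else delta n i) = delta n" by (auto simp: delta_def)
    then show ?thesis using False 0 by simp
  qed
  then have "?g x = 0" by (rule Hom_eq_zero [OF g])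
  moreover have "f x = f (\<lambda>i. if i < m then x i else 0) + ?g x"
    by (subst Hom_add [OF f, symmetric]) (rule arg_cong [of _ _ f], auto)
  ultimately show ?thesis by (simp add: Hom_initial_segment [OF f])
qed

text \<open>A gliding hump: if the supports were unbounded, one could build \<open>x\<close> as a limit of finitely
  supported \<open>s j\<close> with \<open>x \<equiv> s j\<close> modulo \<open>D j\<close>, where some \<open>f \<in> C\<close> satisfies
  \<open>j \<le> \<bar>f (s j)\<bar>\<close> and \<open>2 * \<bar>f (s j)\<bar> < D j\<close>; then \<open>\<bar>f x\<bar> \<ge> j\<close>.\<close>

lemma pointwise_bounded_common_support:
  assumes C: "C \<subseteq> Hom_bs" and bdd: "\<And>x. finite ((\<lambda>f. f x) ` C)"
  obtains m where "\<And>f i. f \<in> C \<Longrightarrow> m \<le> i \<Longrightarrow> f (delta i) = 0"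
proof (rule ccontr)
  assume "\<not> thesis"
  then have hump: "\<exists>f\<in>C. \<exists>n\<ge>m. f (delta n) \<noteq> 0" for m
    using that by blast
  \<comment> \<open>A state is a finitely supported sequence \<open>s\<close>, a modulus
    \<open>D\<close> for all later changes, and a bound \<open>N\<close> beyond which
    \<open>s\<close> is zero.\<close>
  define P where "P = (\<lambda>(j::nat) (s::nat \<Rightarrow> int, D::int, N::nat). D > 0 \<and> (\<forall>k\<ge>N. s k = 0))"
  define Q where "Q = (\<lambda>(j::nat) (s::nat \<Rightarrow> int, D::int, N::nat) (s'::nat \<Rightarrow> int, D'::int, N'::nat).
    N < N' \<and> D dvd D' \<and> (\<forall>k<N. s' k = s k) \<and> (\<forall>k. D dvd s' k - s k) \<and>
    (\<exists>f\<in>C. int j \<le> \<bar>f s'\<bar> \<and> 2 * \<bar>f s'\<bar> < D'))"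
  have "\<exists>S. \<forall>j. P j (S j) \<and> Q j (S j) (S (Suc j))"
  proof (rule dependent_nat_choice)
    show "\<exists>S. P 0 S"
      by (rule exI [of _ "(\<lambda>k. 0, 1, 0)"]) (simp add: P_def)
  next
    fix S j assume PS: "P j S"
    obtain s D N where S: "S = (s, D, N)" by (cases S)
    have D: "D > 0" and s: "\<And>k. k \<ge> N \<Longrightarrow> s k = 0" using PS by (auto simp: P_def S)
    obtain f n where f: "f \<in> C" and n: "n \<ge> N" and fn: "f (delta n) \<noteq> 0"
      using hump [of N] by blast
    \<comment> \<open>The factor \<open>D\<close> keeps \<open>s'\<close> congruent to
      \<open>s\<close>; the other factor makes the new term outweigh \<open>f s\<close> by at least
      \<open>j\<close>.\<close>
    define c where "c = D * (\<bar>f s\<bar> + int j)"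
    define s' where "s' = (\<lambda>i. s i + c * delta n i)"
    have fH: "f \<in> Hom_bs" using f C by blast
    have fs': "f s' = f s + c * f (delta n)"
      unfolding s'_def by (simp add: Hom_add [OF fH] Hom_scale [OF fH])
    have "\<bar>f s\<bar> + int j \<le> \<bar>c * f (delta n)\<bar>"
    proof -
      have "(\<bar>f s\<bar> + int j) * 1 \<le> (\<bar>f s\<bar> + int j) * (D * \<bar>f (delta n)\<bar>)"
        using D fn by (intro mult_left_mono) (auto simp: int_one_le_iff_zero_less)
      then show ?thesis using D by (simp add: c_def abs_mult algebra_simps)
    qed
    then have big: "int j \<le> \<bar>f s'\<bar>" unfolding fs' by linarith
    \<comment> \<open>A multiple of \<open>D\<close> above twice the value just reached; the
      \<open>+ 1\<close> gives strictness, and positivity even if \<open>f s' = 0\<close>.\<close>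
    define D' where "D' = D * (2 * \<bar>f s'\<bar> + 1)"
    have "1 * (2 * \<bar>f s'\<bar> + 1) \<le> D'"
      unfolding D'_def using D by (intro mult_right_mono) auto
    then have D': "2 * \<bar>f s'\<bar> < D'" by simp
    have "P (Suc j) (s', D', Suc n)"
      using n s D' by (auto simp: P_def s'_def delta_def)
    moreover have "Q j S (s', D', Suc n)"
      using n f big D' by (auto simp: Q_def S s'_def delta_def D'_def c_def)
    ultimately show "\<exists>S'. P (Suc j) S' \<and> Q j S S'" by blast
  qed
  then obtain S where S: "\<And>j. P j (S j)" "\<And>j. Q j (S j) (S (Suc j))" by blast
  define s D N where "s = fst \<circ> S" and "D = fst \<circ> snd \<circ> S" and "N = snd \<circ> snd \<circ> S"
  have SS: "S j = (s j, D j, N j)" for j by (simp add: s_def D_def N_def)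
  have N: "N j < N (Suc j)" and Dd: "D j dvd D (Suc j)" and sk: "k < N j \<Longrightarrow> s (Suc j) k = s j k"
    and sd: "D j dvd s (Suc j) k - s j k"
    and f: "\<exists>f\<in>C. int j \<le> \<bar>f (s (Suc j))\<bar> \<and> 2 * \<bar>f (s (Suc j))\<bar> < D (Suc j)" for j k
    using S(2) [of j] by (auto simp: Q_def SS)
  have Nj: "j \<le> N j" for j
    by (induction j) (use N Suc_leI order_le_less_trans in \<open>blast+\<close>)
  have stab: "j \<le> i \<Longrightarrow> k < N j \<Longrightarrow> s i k = s j k \<and> N j \<le> N i" for i j k
  proof (induction i rule: dec_induct)
    case (step i)
    then show ?case using N [of i] sk [of k i] by simp
  qed simp
  have cong: "j \<le> i \<Longrightarrow> D j dvd D i \<and> D j dvd s i k - s j k" for i j k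
  proof (induction i rule: dec_induct)
    case base show ?case by simp
  next
    case (step i)
    then have "D j dvd (s (Suc i) k - s i k) + (s i k - s j k)"
      by (meson sd dvd_add dvd_trans)
    then show ?case using step Dd dvd_trans by auto
  qed
  \<comment> \<open>Coordinate \<open>k\<close> is frozen from stage \<open>Suc k\<close> on, since
    \<open>k < Suc k \<le> N (Suc k)\<close>.\<close>
  define x where "x = (\<lambda>k. s (Suc k) k)"
  have x: "D j dvd x k - s j k" for j k
  proof -
    have "x k = s (max j (Suc k)) k"
      using stab [of "Suc k" "max j (Suc k)" k] Nj [of "Suc k"] by (auto simp: x_def)
    then show ?thesis using cong [of j "max j (Suc k)" k] by simp
  qed
  have "\<exists>f\<in>C. int j \<le> \<bar>f x\<bar>" for j
  proof -
    obtain f where fC: "f \<in> C" and f1: "int j \<le> \<bar>f (s (Suc j))\<bar>" and f2: "2 * \<bar>f (s (Suc j))\<bar> < D (Suc j)"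
      using f [of j] by blast
    have fH: "f \<in> Hom_bs" using fC C by blast
    obtain w where w: "\<And>k. x k - s (Suc j) k = D (Suc j) * w k"
      using x [of "Suc j"] unfolding dvd_def by metis
    then have "x = (\<lambda>k. s (Suc j) k + D (Suc j) * w k)" by (simp add: fun_eq_iff algebra_simps flip: w)
    then have fx: "f x = f (s (Suc j)) + D (Suc j) * f w"
      by (simp add: Hom_add [OF fH] Hom_scale [OF fH])
    \<comment> \<open>The correction is a multiple of \<open>D (Suc j)\<close>. If nonzero, it
      exceeds twice the old value in size, so it cannot bring the sum closer to 0 than the old value
      was.\<close>
    have "\<bar>f (s (Suc j))\<bar> \<le> \<bar>f x\<bar>"
    proof (cases "f w = 0")
      case False
      then have "D (Suc j) * 1 \<le> \<bar>D (Suc j)\<bar> * \<bar>f w\<bar>"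
        by (intro mult_mono) auto
      then show ?thesis using f2 unfolding fx abs_mult [symmetric] by linarith
    qed (simp add: fx)
    then show ?thesis using f1 fC order_trans by blast
  qed
  then have "int j \<le> Max ((\<lambda>y. \<bar>y\<bar>) ` (\<lambda>f. f x) ` C)" for j
    using bdd [of x] by (meson Max_ge finite_imageI image_eqI order_trans)
  from this [of "nat (Max ((\<lambda>y. \<bar>y\<bar>) ` (\<lambda>f. f x) ` C) + 1)"] show False by linarith
qed

section \<open>\<open>Hom_baer_specker\<close> has no isolated points\<close>

text \<open>Induction starting from a coordinate projection. The bound \<open>N\<close> strengthens
  the claim: the induction step needs a second homomorphism whose support reaches beyond that of the
  first, so that a combination of both killing \<open>x\<close> is still nonzero.\<close>

lemma exists_Hom_vanishing_on_finite:
  assumes "finite F"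
  shows "\<exists>g\<in>Hom_bs. (\<forall>x\<in>F. g x = 0) \<and> (\<exists>k\<ge>N. g (delta k) \<noteq> 0)"
  using assms
proof (induction F arbitrary: N)
  case empty
  show ?case by (rule bexI [OF _ Hom_proj [of N]]) (auto simp: delta_def)
next
  case (insert x F)
  obtain g k where g: "g \<in> Hom_bs" "\<And>y. y \<in> F \<Longrightarrow> g y = 0" "k \<ge> N" "g (delta k) \<noteq> 0"
    using insert.IH [of N] by blast
  show ?case
  proof (cases "g x = 0")
    case True then show ?thesis using g by blast
  next
    case False
    obtain M where M: "\<And>i. M \<le> i \<Longrightarrow> g (delta i) = 0"
      by (rule pointwise_bounded_common_support [of "{g}"]) (use g(1) in auto)
    obtain h l where h: "h \<in> Hom_bs" "\<And>y. y \<in> F \<Longrightarrow> h y = 0" "l \<ge> max M N" "h (delta l) \<noteq> 0"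
      using insert.IH [of "max M N"] by blast
    show ?thesis
    proof (rule bexI [of _ "\<lambda>y. h x * g y - g x * h y"], intro conjI)
      \<comment> \<open>At \<open>l \<ge> M\<close> the term with \<open>g\<close> vanishes, leaving
        \<open>- g x * h (delta l)\<close>, a product of nonzero factors.\<close>
      show "\<exists>k\<ge>N. h x * g (delta k) - g x * h (delta k) \<noteq> 0"
        using h M False by (intro exI [of _ l]) auto
      show "(\<lambda>y. h x * g y - g x * h y) \<in> Hom_bs"
        using g(1) h(1) by (simp add: mem_Hom algebra_simps)
    qed (use g h in auto)
  qed
qed

text \<open>A basic neighbourhood of \<open>g\<close> restricts values at finitely many arguments
  only; adding a nonzero homomorphism that vanishes there gives another point of it.\<close>

lemma singleton_not_open_Hom_baer_specker:
  "\<not> openin (group_topology Hom_baer_specker) {g}"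
proof
  let ?P = "product_topology (\<lambda>_::nat \<Rightarrow> int. discrete_topology (UNIV :: int set)) UNIV"
  assume "openin (group_topology Hom_baer_specker) {g}"
  then obtain W where W: "openin ?P W" and Wg: "{g} = W \<inter> Hom_bs"
    by (auto simp: Hom_baer_specker_def openin_subtopology)
  then have "g \<in> W" and g: "g \<in> Hom_bs" by auto
  then obtain U where U: "finite {i. U i \<noteq> UNIV}" "g \<in> Pi\<^sub>E UNIV U" "Pi\<^sub>E UNIV U \<subseteq> W"
    using W by (auto simp: openin_product_topology_alt)
  obtain h k where h: "h \<in> Hom_bs" "\<And>x. U x \<noteq> UNIV \<Longrightarrow> h x = 0" "h (delta k) \<noteq> 0"
    using exists_Hom_vanishing_on_finite [OF U(1), of 0] by blast
  have "(\<lambda>x. g x + h x) \<in> Pi\<^sub>E UNIV U"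
    using U(2) h(2) by (fastforce simp: PiE_iff)
  moreover have "(\<lambda>x. g x + h x) \<in> Hom_bs"
    using g h(1) by (simp add: mem_Hom)
  ultimately have "(\<lambda>x. g x + h x) = g" using U(3) Wg by blast
  then show False using h(3) by (metis add_cancel_right_right)
qed

section \<open>The circle group and its small subgroups\<close>

abbreviation circ :: "real \<Rightarrow> real set" where
  "circ x \<equiv> \<int> #>\<^bsub>real_group\<^esub> x"

lemma circ_eq_iff: "circ x = circ y \<longleftrightarrow> x - y \<in> \<int>"
proof -
  have mem: "u \<in> circ v \<longleftrightarrow> u - v \<in> \<int>" for u v
    by (auto simp: r_coset_def intro: bexI [of _ "u - v"])
  show ?thesis
  proof
    assume "circ x = circ y"
    then show "x - y \<in> \<int>" using mem [of x x] mem [of x y] by simp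
  next
    assume d: "x - y \<in> \<int>"
    have "u - x \<in> \<int> \<longleftrightarrow> u - y \<in> \<int>" for u
      using Ints_add [OF _ d, of "u - x"] Ints_diff [OF _ d, of "u - y"] by auto
    then show "circ x = circ y" by (auto simp: mem)
  qed
qed

lemma carrier_circle: "carrier circle_group = range circ"
  by (simp add: circle_group_def carrier_FactGroup)

lemma mult_circle: "circ x \<otimes>\<^bsub>circle_group\<^esub> circ y = circ (x + y)"
  using normal.rcos_sum [OF normal_Ints, of x y] by (simp add: circle_group_def)

lemma openin_circle:
  "openin (group_topology circle_group) U \<longleftrightarrow> U \<subseteq> range circ \<and> open {x. circ x \<in> U}"
  by (simp add: circle_group_def openin_circle_topology carrier_FactGroup)

lemma continuous_map_circ: "continuous_map euclidean (group_topology circle_group) circ"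
  using quotient_imp_continuous_map [OF quotient_map_circle] by (simp add: circle_group_def)

text \<open>The radius is small enough that \<open>\<bar>s + s - s'\<bar> < 1\<close> for
  representatives \<open>s\<close> of a point and \<open>s'\<close> of its double, both taken within
  the arc; an integer of that size is 0.\<close>

definition small_arc :: "real set set" where
  "small_arc = circ ` {-1/4<..<1/4}"

lemma openin_small_arc: "openin (group_topology circle_group) small_arc"
proof -
  have "{x. circ x \<in> small_arc} = (\<Union>k\<in>(\<int> :: real set). ball k (1/4))"
  proof (intro equalityI subsetI)
    fix x assume "x \<in> {x. circ x \<in> small_arc}"
    then obtain y where y: "-1/4 < y" "y < 1/4" "circ x = circ y" by (auto simp: small_arc_def)
    then show "x \<in> (\<Union>k\<in>\<int>. ball k (1/4))"
      by (intro UN_I [of "x - y"]) (auto simp: circ_eq_iff dist_real_def)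
  next
    fix x assume "x \<in> (\<Union>k\<in>(\<int> :: real set). ball k (1/4))"
    then obtain k where k: "k \<in> \<int>" "\<bar>k - x\<bar> < 1/4" by (auto simp: dist_real_def)
    then have "circ x = circ (x - k)" "x - k \<in> {-1/4<..<1/4}"
      by (auto simp: circ_eq_iff abs_if split: if_splits)
    then show "x \<in> {x. circ x \<in> small_arc}" by (auto simp: small_arc_def)
  qed
  then show ?thesis by (auto simp: openin_circle small_arc_def)
qed

lemma openin_circle_minus_one:
  "openin (group_topology circle_group) (range circ - {circ 0})"
proof -
  have "{x. circ x \<in> range circ - {circ 0}} = - \<int>"
    by (auto simp: circ_eq_iff)
  then show ?thesis by (auto simp: openin_circle)
qed

text \<open>If \<open>h (t + t)\<close> also lies in the arc, the representative of
  \<open>h t\<close> is exactly half that of \<open>h (t + t)\<close>. Iterating, the representative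
  of every value is below \<open>1/4 / 2 ^ k\<close> for all \<open>k\<close>.\<close>

lemma no_small_subgroups:
  assumes add: "\<And>s t. h (s + t) = h s \<otimes>\<^bsub>circle_group\<^esub> h t"
    and small: "\<And>t::real. h t \<in> small_arc"
  shows "h t = circ 0"
proof -
  have *: "\<exists>s. h t = circ s \<and> \<bar>s\<bar> < 1/4 / 2 ^ k" for k t
  proof (induction k arbitrary: t)
    case 0
    obtain s where "h t = circ s" "\<bar>s\<bar> < 1/4"
      using small [of t] by (auto simp: small_arc_def abs_less_iff)
    then show ?case by auto
  next
    case (Suc k)
    obtain s where s: "h t = circ s" "\<bar>s\<bar> < 1/4"
      using small [of t] by (auto simp: small_arc_def abs_less_iff)
    obtain s' where s': "h (t + t) = circ s'" "\<bar>s'\<bar> < 1/4 / 2 ^ k"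
      using Suc by blast
    have "1/4 / 2 ^ k \<le> (1/4 :: real)"
      by (simp add: field_simps)
    then have lt: "\<bar>s + s - s'\<bar> < 1" using s(2) s'(2) by linarith
    have "circ (s + s) = circ s'" using add [of t t] s s' by (simp add: mult_circle)
    then have "s + s - s' = 0" using lt by (intro Ints_nonzero_abs_less1) (simp_all only: circ_eq_iff)
    then have "\<bar>s\<bar> = \<bar>s'\<bar> / 2" by linarith
    then have "\<bar>s\<bar> < 1/4 / 2 ^ k / 2"
      using divide_strict_right_mono [OF s'(2), of 2] by simp
    then show ?case using s(1) by (intro exI [of _ s]) simp
  qed
  obtain s where s: "h t = circ s" "\<bar>s\<bar> < 1/4" using *[of t 0] by auto
  \<comment> \<open>The representative found above may depend on \<open>k\<close>; two
    representatives in the arc differ by an integer of size below 1, hence coincide.\<close>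
  have "\<bar>s\<bar> < 1/4 / 2 ^ k" for k
  proof -
    obtain r where r: "h t = circ r" "\<bar>r\<bar> < 1/4 / 2 ^ k" using * by blast
    have "1/4 / 2 ^ k \<le> (1/4 :: real)"
      by (simp add: field_simps)
    then have "\<bar>s - r\<bar> < 1" using s r by linarith
    moreover have "s - r \<in> \<int>" using s r by (simp add: circ_eq_iff [symmetric])
    ultimately have "s - r = 0" by (intro Ints_nonzero_abs_less1)
    then show ?thesis using r by simp
  qed
  then have "4 * \<bar>s\<bar> \<le> (1/2) ^ k" for k
    by (simp add: field_simps less_imp_le)
  moreover have "(\<lambda>k. (1/2 :: real) ^ k) \<longlonglongrightarrow> 0"
    by (rule LIMSEQ_realpow_zero) auto
  ultimately have "4 * \<bar>s\<bar> \<le> 0"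
    by (intro LIMSEQ_le_const [of _ 0]) auto
  then show ?thesis using s by simp
qed

section \<open>Compact subsets of \<open>Hom_baer_specker\<close> and neighbourhoods in its
  dual\<close>

lemma continuous_map_Hom_eval:
  "continuous_map (group_topology Hom_baer_specker) (discrete_topology UNIV) (\<lambda>f. f x)"
  unfolding Hom_baer_specker_def
  by (auto intro!: continuous_map_from_subtopology continuous_map_product_projection)

lemma topspace_Hom_baer_specker: "topspace (group_topology Hom_baer_specker) = Hom_bs"
  and carrier_Hom_baer_specker: "carrier Hom_baer_specker = Hom_bs"
  and mult_Hom_baer_specker: "f \<otimes>\<^bsub>Hom_baer_specker\<^esub> g = (\<lambda>x. f x + g x)"
  by (auto simp: Hom_baer_specker_def)

text \<open>Evaluation is continuous into the discrete integers, where compact sets are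
  finite.\<close>

lemma compactin_Hom_finite_values:
  assumes "compactin (group_topology Hom_baer_specker) C"
  shows "finite ((\<lambda>f. f x) ` C)"
  using image_compactin [OF assms continuous_map_Hom_eval, of x]
  by (simp add: compactin_discrete_topology)

lemma compactin_Hom_common_support:
  assumes "compactin (group_topology Hom_baer_specker) C"
  obtains m where "\<And>f i. f \<in> C \<Longrightarrow> m \<le> i \<Longrightarrow> f (delta i) = 0"
proof (rule pointwise_bounded_common_support)
  show "C \<subseteq> Hom_bs"
    using compactin_subset_topspace [OF assms] by (simp add: topspace_Hom_baer_specker)
qed (use that compactin_Hom_finite_values [OF assms] in auto)

text \<open>A subbasic set tests characters on a compact set, whose members are all supported below
  a common \<open>m\<close>. Finite intersections are handled by taking the larger bound.\<close>

lemma neighbourhood_agree_on_finite_support: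
  assumes W: "openin (compact_open_topology Hom_baer_specker) W" and y: "y \<in> W"
  obtains m where "\<And>z. \<lbrakk>z \<in> characters Hom_baer_specker;
      \<And>f. f \<in> Hom_bs \<Longrightarrow> (\<And>i. m \<le> i \<Longrightarrow> f (delta i) = 0) \<Longrightarrow> z f = y f\<rbrakk> \<Longrightarrow> z \<in> W"
proof -
  define A where "A m = {z \<in> characters Hom_baer_specker.
      \<forall>f\<in>Hom_bs. (\<forall>i\<ge>m. f (delta i) = 0) \<longrightarrow> z f = y f}" for m
  have anti: "A n \<subseteq> A m" if "m \<le> n" for m n
    using that by (auto simp: A_def)
  have "y \<in> W \<longrightarrow> (\<exists>m. A m \<subseteq> W)"
    using openin_topology_generated_by [OF W [unfolded compact_open_topology_def]]
  proof (induction rule: generate_topology_on.induct)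
    case Empty then show ?case by simp
  next
    case (Int a b)
    show ?case
    proof
      assume "y \<in> a \<inter> b"
      then obtain m n where "A m \<subseteq> a" "A n \<subseteq> b"
        using Int by auto
      then have "A (max m n) \<subseteq> a \<inter> b"
        using anti [of m "max m n"] anti [of n "max m n"] by auto
      then show "\<exists>m. A m \<subseteq> a \<inter> b" ..
    qed
  next
    case (UN K) then show ?case by (meson Union_iff Union_upper subset_trans)
  next
    case (Basis s)
    then obtain C U where s: "s = {\<alpha> \<in> characters Hom_baer_specker. \<alpha> ` C \<subseteq> U}"
      and C: "compactin (group_topology Hom_baer_specker) C" by auto
    obtain m where m: "\<And>f i. f \<in> C \<Longrightarrow> m \<le> i \<Longrightarrow> f (delta i) = 0"
      by (rule compactin_Hom_common_support [OF C]) blast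
    have CH: "C \<subseteq> Hom_bs"
      using compactin_subset_topspace [OF C] by (simp add: topspace_Hom_baer_specker)
    show ?case
    proof
      assume "y \<in> s"
      then have U: "y f \<in> U" if "f \<in> C" for f using that by (auto simp: s)
      have "A m \<subseteq> s"
      proof
        fix z assume z: "z \<in> A m"
        have "z f = y f" if "f \<in> C" for f
          using z m [OF that] that CH by (auto simp: A_def)
        then show "z \<in> s" using z U by (auto simp: s A_def)
      qed
      then show "\<exists>m. A m \<subseteq> s" ..
    qed
  qed
  then obtain m where m: "A m \<subseteq> W" using y by blast
  show thesis
  proof (rule that [of m])
    fix z assume "z \<in> characters Hom_baer_specker"
      and "\<And>f. f \<in> Hom_bs \<Longrightarrow> (\<And>i. m \<le> i \<Longrightarrow> f (delta i) = 0) \<Longrightarrow> z f = y f"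
    then have "z \<in> A m" by (simp add: A_def)
    then show "z \<in> W" using m by blast
  qed
qed

section \<open>Characters of finite type and the coordinate circles\<close>

text \<open>The pullback of a character of the group of integer \<open>m\<close>-tuples along
  \<open>f \<mapsto> (f (delta 0), ..., f (delta (m - 1)))\<close>.\<close>

definition finite_character :: "(nat \<Rightarrow> real) \<Rightarrow> nat \<Rightarrow> ((nat \<Rightarrow> int) \<Rightarrow> int) \<Rightarrow> real set" where
  "finite_character c m = (\<lambda>f\<in>Hom_bs. circ (\<Sum>i<m. c i * of_int (f (delta i))))"

definition coordinate_character :: "nat \<Rightarrow> real \<Rightarrow> ((nat \<Rightarrow> int) \<Rightarrow> int) \<Rightarrow> real set" where
  "coordinate_character n t = finite_character (\<lambda>i. if i = n then t else 0) (Suc n)"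

lemma finite_character_in_characters: "finite_character c m \<in> characters Hom_baer_specker"
proof -
  let ?S = "group_topology Hom_baer_specker"
  have "finite_character c m \<in> hom Hom_baer_specker circle_group"
    by (auto simp: hom_def carrier_Hom_baer_specker mult_Hom_baer_specker carrier_circle mult_circle
        finite_character_def distrib_left sum.distrib)
  moreover have "finite_character c m \<in> extensional (carrier Hom_baer_specker)"
    by (simp add: finite_character_def carrier_Hom_baer_specker)
  moreover have "continuous_map ?S (group_topology circle_group) (finite_character c m)"
  proof -
    have "continuous_map ?S euclideanreal (\<lambda>f. real_of_int (f (delta i)))" for i
      using continuous_map_compose [OF continuous_map_Hom_eval [of "delta i"],
          of euclideanreal real_of_int]
      by (simp add: o_def)
    then have "continuous_map ?S euclideanreal (\<lambda>f. \<Sum>i<m. c i * of_int (f (delta i)))"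
      by (intro continuous_map_sum continuous_map_real_mult) auto
    from continuous_map_compose [OF this continuous_map_circ]
    show ?thesis
      by (rule continuous_map_eq) (simp add: finite_character_def topspace_Hom_baer_specker)
  qed
  ultimately show ?thesis by (simp add: characters_def)
qed

lemma coordinate_character_apply:
  "f \<in> Hom_bs \<Longrightarrow> coordinate_character n t f = circ (t * of_int (f (delta n)))"
  by (simp add: coordinate_character_def finite_character_def if_distrib [of "\<lambda>x. x * _"] cong: if_cong)

lemma coordinate_character_in_characters: "coordinate_character n t \<in> characters Hom_baer_specker"
  by (simp add: coordinate_character_def finite_character_in_characters)

lemma mult_dual_group_Hom:
  "\<alpha> \<otimes>\<^bsub>dual_group Hom_baer_specker\<^esub> \<beta> = (\<lambda>f\<in>Hom_bs. \<alpha> f \<otimes>\<^bsub>circle_group\<^esub> \<beta> f)"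
  by (simp add: dual_group_def carrier_Hom_baer_specker)

text \<open>Characters of the dual are restricted to \<open>characters Hom_baer_specker\<close>, so
  checking that the constant one is multiplicative requires products to stay in this set.\<close>

lemma characters_mult_closed:
  assumes \<alpha>: "\<alpha> \<in> characters Hom_baer_specker" and \<beta>: "\<beta> \<in> characters Hom_baer_specker"
  shows "\<alpha> \<otimes>\<^bsub>dual_group Hom_baer_specker\<^esub> \<beta> \<in> characters Hom_baer_specker"
proof -
  interpret G: abelian_topological_group Hom_baer_specker
    by (rule abelian_topological_group_Hom_baer_specker)
  interpret C: abelian_topological_group circle_group
    by (rule abelian_topological_group_circle)
  let ?\<gamma> = "\<lambda>f\<in>carrier Hom_baer_specker. \<alpha> f \<otimes>\<^bsub>circle_group\<^esub> \<beta> f"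
  have \<alpha>h: "\<alpha> \<in> hom Hom_baer_specker circle_group" and \<beta>h: "\<beta> \<in> hom Hom_baer_specker circle_group"
    and cont: "continuous_map (group_topology Hom_baer_specker) (group_topology circle_group) \<alpha>"
      "continuous_map (group_topology Hom_baer_specker) (group_topology circle_group) \<beta>"
    using \<alpha> \<beta> by (auto simp: characters_def)
  have "?\<gamma> \<in> hom Hom_baer_specker circle_group"
    using hom_in_carrier [OF \<alpha>h] hom_in_carrier [OF \<beta>h]
    by (intro homI) (auto simp: hom_mult [OF \<alpha>h] hom_mult [OF \<beta>h] C.m_ac)
  moreover have "continuous_map (group_topology Hom_baer_specker) (group_topology circle_group) ?\<gamma>"
    using continuous_map_compose [OF continuous_map_pairedI [OF cont] C.continuous_mult]
    by (rule continuous_map_eq) (simp add: G.topspace_group)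
  ultimately show ?thesis
    by (simp add: characters_def dual_group_def)
qed

text \<open>Together with \<open>finite_character_0\<close>, this shows by induction that the
  coordinate circles generate all finite characters.\<close>

lemma finite_character_Suc:
  "finite_character c (Suc m) =
     finite_character c m \<otimes>\<^bsub>dual_group Hom_baer_specker\<^esub> coordinate_character m (c m)"
  by (auto simp: mult_dual_group_Hom finite_character_def coordinate_character_apply mult_circle
      fun_eq_iff restrict_def)

lemma coordinate_character_add:
  "coordinate_character n (s + t) =
     coordinate_character n s \<otimes>\<^bsub>dual_group Hom_baer_specker\<^esub> coordinate_character n t"
proof -
  have "coordinate_character n r = (\<lambda>f\<in>Hom_bs. circ (r * of_int (f (delta n))))" for r
    by (rule extensionalityI [of _ Hom_bs])
      (auto simp: coordinate_character_apply, simp add: coordinate_character_def finite_character_def)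
  then show ?thesis
    by (auto simp: mult_dual_group_Hom mult_circle fun_eq_iff restrict_def distrib_right)
qed

lemma finite_character_0: "finite_character c 0 = coordinate_character 0 0"
  by (simp add: coordinate_character_def finite_character_def)

text \<open>On a compact set \<open>f (delta n)\<close> takes finitely many values \<open>k\<close>,
  so the preimage of a subbasic set is a finite intersection of open conditions on
  \<open>t * k\<close>.\<close>

lemma continuous_map_coordinate_character:
  "continuous_map euclidean (compact_open_topology Hom_baer_specker) (coordinate_character n)"
  unfolding compact_open_topology_def
proof (rule continuous_on_generated_topo)
  fix V
  assume "V \<in> {{\<alpha> \<in> characters Hom_baer_specker. \<alpha> ` K \<subseteq> U} |K U.
      compactin (group_topology Hom_baer_specker) K \<and> openin (group_topology circle_group) U}"
  then obtain C U where V: "V = {\<alpha> \<in> characters Hom_baer_specker. \<alpha> ` C \<subseteq> U}"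
    and C: "compactin (group_topology Hom_baer_specker) C"
    and U: "openin (group_topology circle_group) U" by auto
  have CH: "C \<subseteq> Hom_bs"
    using compactin_subset_topspace [OF C] by (simp add: topspace_Hom_baer_specker)
  have "coordinate_character n -` V = {t. \<forall>f\<in>C. circ (t * of_int (f (delta n))) \<in> U}"
    using CH by (auto simp: V coordinate_character_in_characters image_subset_iff
        coordinate_character_apply subset_iff)
  also have "\<dots> = (\<Inter>k\<in>(\<lambda>f. f (delta n)) ` C. (\<lambda>t. t * of_int k) -` {x. circ x \<in> U})"
    by auto
  also have "open \<dots>"
    using compactin_Hom_finite_values [OF C] U
    by (intro open_INT ballI open_vimage) (auto simp: openin_circle intro!: continuous_intros)
  finally show "openin euclidean (coordinate_character n -` V \<inter> topspace euclidean)" by simp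
next
  show "coordinate_character n ` topspace euclidean \<subseteq> \<Union> {{\<alpha> \<in> characters Hom_baer_specker. \<alpha> ` K \<subseteq> U} |K U.
      compactin (group_topology Hom_baer_specker) K \<and> openin (group_topology circle_group) U}"
    using coordinate_character_in_characters
      topspace_compact_open_topology [of Hom_baer_specker]
    unfolding compact_open_topology_def topology_generated_by_topspace by blast
qed

text \<open>Makes each circle the image of the compact interval \<open>{0..1}\<close>.\<close>

lemma coordinate_character_periodic:
  "coordinate_character n t = coordinate_character n (frac t)"
proof (rule extensionalityI [of _ Hom_bs])
  fix f assume "f \<in> Hom_bs"
  moreover have "t * of_int k - frac t * of_int k = of_int (\<lfloor>t\<rfloor> * k)" for k
    by (simp add: frac_def algebra_simps)
  ultimately show "coordinate_character n t f = coordinate_character n (frac t) f"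
    by (simp add: coordinate_character_apply circ_eq_iff)
qed (simp_all add: coordinate_character_def finite_character_def)

text \<open>The circles \<open>range (coordinate_character n)\<close> converge to the trivial character, because the
  elements of a compact set have a common finite support.\<close>

lemma compactin_coordinate_characters:
  "compactin (compact_open_topology Hom_baer_specker) (\<Union>n. range (coordinate_character n))"
    (is "compactin ?T ?K")
  unfolding compactin_def
proof (intro conjI allI impI)
  show "?K \<subseteq> topspace ?T"
    using coordinate_character_in_characters by auto
  have circle: "compactin ?T (range (coordinate_character n))" for n
  proof -
    have "frac t \<in> {0..1}" for t :: real
      using frac_lt_1 [of t] by simp
    then have "range (coordinate_character n) = coordinate_character n ` {0..1}"
      using coordinate_character_periodic [of n] by blast
    then show ?thesis
      using image_compactin [OF _ continuous_map_coordinate_character [of n], of "{0..1}"] by simp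
  qed
  fix \<U> assume "(\<forall>U\<in>\<U>. openin ?T U) \<and> ?K \<subseteq> \<Union> \<U>"
  then have op: "\<And>U. U \<in> \<U> \<Longrightarrow> openin ?T U" and cov: "?K \<subseteq> \<Union> \<U>" by auto
  \<comment> \<open>\<open>coordinate_character 0 0\<close> is the trivial character; a member of
    the cover around it absorbs all but finitely many circles.\<close>
  obtain O1 where O1: "O1 \<in> \<U>" "coordinate_character 0 0 \<in> O1" using cov by blast
  obtain m where m: "\<And>z. \<lbrakk>z \<in> characters Hom_baer_specker;
      \<And>f. f \<in> Hom_bs \<Longrightarrow> (\<And>i. m \<le> i \<Longrightarrow> f (delta i) = 0) \<Longrightarrow> z f = coordinate_character 0 0 f\<rbrakk>
      \<Longrightarrow> z \<in> O1"
    by (rule neighbourhood_agree_on_finite_support [OF op [OF O1(1)] O1(2)]) blast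
  have tail: "range (coordinate_character n) \<subseteq> O1" if "n \<ge> m" for n
    using that by (auto intro!: m coordinate_character_in_characters simp: coordinate_character_apply)
  have "compactin ?T (\<Union>n<m. range (coordinate_character n))"
    by (intro compactin_Union) (auto intro: circle)
  moreover have "(\<Union>n<m. range (coordinate_character n)) \<subseteq> \<Union> \<U>"
    using cov by blast
  ultimately obtain \<F> where F: "finite \<F>" "\<F> \<subseteq> \<U>" "(\<Union>n<m. range (coordinate_character n)) \<subseteq> \<Union> \<F>"
    using op unfolding compactin_def by meson
  have "?K \<subseteq> \<Union> (insert O1 \<F>)"
  proof
    fix z assume "z \<in> ?K"
    then obtain n where "z \<in> range (coordinate_character n)" by blast
    then show "z \<in> \<Union> (insert O1 \<F>)"
      using tail F(3) by (cases "n < m") (auto simp: not_less)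
  qed
  then show "\<exists>\<F>. finite \<F> \<and> \<F> \<subseteq> \<U> \<and> ?K \<subseteq> \<Union> \<F>"
    using F O1 by (intro exI [of _ "insert O1 \<F>"]) auto
qed

section \<open>Discreteness of the second dual\<close>

text \<open>Density of the finite characters: \<open>\<xi>\<close> is nontrivial on an open set, and
  if this contains \<open>y\<close>, it also contains a finite character agreeing with
  \<open>y\<close> on all homomorphisms supported below some \<open>m\<close>.\<close>

lemma character_determined_by_finite_characters:
  assumes xi: "\<xi> \<in> characters (dual_group Hom_baer_specker)"
    and triv: "\<And>c m. \<xi> (finite_character c m) = circ 0"
    and y: "y \<in> characters Hom_baer_specker"
  shows "\<xi> y = circ 0"
proof (rule ccontr)
  let ?G = "Hom_baer_specker"
  assume ne: "\<xi> y \<noteq> circ 0"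
  have cont: "continuous_map (compact_open_topology ?G) (group_topology circle_group) \<xi>"
    and hom: "\<xi> \<in> hom (dual_group ?G) circle_group"
    using xi by (auto simp: characters_def dual_group_def)
  let ?W = "{z \<in> characters ?G. \<xi> z \<in> range circ - {circ 0}}"
  have "openin (compact_open_topology ?G) ?W"
    using openin_continuous_map_preimage [OF cont openin_circle_minus_one] by simp
  moreover have "y \<in> ?W"
    using ne y hom by (auto simp: hom_def dual_group_def carrier_circle Pi_iff)
  ultimately obtain m where m: "\<And>z. \<lbrakk>z \<in> characters ?G;
      \<And>f. f \<in> Hom_bs \<Longrightarrow> (\<And>i. m \<le> i \<Longrightarrow> f (delta i) = 0) \<Longrightarrow> z f = y f\<rbrakk> \<Longrightarrow> z \<in> ?W"
    by (rule neighbourhood_agree_on_finite_support) blast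
  have yhom: "f \<in> Hom_bs \<Longrightarrow> g \<in> Hom_bs \<Longrightarrow> y (\<lambda>x. f x + g x) = y f \<otimes>\<^bsub>circle_group\<^esub> y g"
    and yran: "f \<in> Hom_bs \<Longrightarrow> y f \<in> range circ" for f g
    using y by (auto simp: characters_def hom_def carrier_Hom_baer_specker mult_Hom_baer_specker carrier_circle Pi_iff)
  have "\<exists>t. y (\<lambda>x. x i) = circ t" for i
    using yran [OF Hom_proj [of i]] by auto
  \<comment> \<open>The coefficients of the approximating finite character are read off from
    \<open>y\<close> on the coordinate projections.\<close>
  then obtain c where c: "\<And>i. y (\<lambda>x. x i) = circ (c i)" by metis
  have zero: "y (\<lambda>x. 0) = circ 0"
  proof -
    have z: "(\<lambda>x. 0) \<in> Hom_bs" by (simp add: mem_Hom)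
    obtain t where t: "y (\<lambda>x. 0) = circ t" using yran [OF z] by auto
    then have "circ t = circ (t + t)" using yhom [OF z z] by (simp add: mult_circle)
    then have "- t \<in> \<int>" by (simp add: circ_eq_iff)
    then show ?thesis using t by (simp add: circ_eq_iff)
  qed
  have scale: "y (\<lambda>x. x i * k) = circ (c i * of_int k)" for i k
  proof -
    have H: "(\<lambda>x. x i * k) \<in> Hom_bs" for k by (simp add: mem_Hom algebra_simps)
    have nat: "y (\<lambda>x. x i * int j) = circ (c i * of_int (int j))" for j
    proof (induction j)
      case 0 then show ?case by (simp add: zero)
    next
      case (Suc j)
      then show ?case
        using yhom [OF H [of "int j"] Hom_proj [of i]]
        by (simp add: c mult_circle algebra_simps)
    qed
    show ?thesis
    proof (cases "k \<ge> 0")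
      case True then show ?thesis using nat [of "nat k"] by simp
    next
      case False
      obtain t where t: "y (\<lambda>x. x i * k) = circ t" using yran [OF H] by auto
      have "circ 0 = circ (t + c i * of_int (- k))"
        using yhom [OF H [of k] H [of "- k"]] nat [of "nat (- k)"] False t
        by (simp add: zero mult_circle)
      then have "- (t - c i * of_int k) \<in> \<int>" by (simp add: circ_eq_iff)
      then have "t - c i * of_int k \<in> \<int>" by (metis Ints_minus minus_minus)
      then show ?thesis using t by (simp add: circ_eq_iff)
    qed
  qed
  have lin: "y (\<lambda>x. \<Sum>i<m. x i * k i) = circ (\<Sum>i<m. c i * of_int (k i))" for k m
  proof (induction m)
    case 0 then show ?case by (simp add: zero)
  next
    case (Suc m)
    have H: "(\<lambda>x. \<Sum>i<m. x i * k i) \<in> Hom_bs" "(\<lambda>x. x m * k m) \<in> Hom_bs"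
      by (simp_all add: mem_Hom distrib_right sum.distrib)
    show ?case using yhom [OF H] Suc scale by (simp add: mult_circle)
  qed
  have "finite_character c m \<in> ?W"
  proof (rule m [OF finite_character_in_characters])
    fix f assume f: "f \<in> Hom_bs" and 0: "\<And>i. m \<le> i \<Longrightarrow> f (delta i) = 0"
    \<comment> \<open>By Specker's theorem \<open>f\<close> is an integer combination of coordinate
      projections, where \<open>lin\<close> computes \<open>y\<close>.\<close>
    have "f = (\<lambda>x. \<Sum>i<m. x i * f (delta i))"
      using Hom_finite_support [OF f 0] by blast
    then show "finite_character c m f = y f"
      using lin [of "\<lambda>i. f (delta i)" m] f by (simp add: finite_character_def)
  qed
  then show False using triv by auto
qed

text \<open>A single subbasic set isolates the trivial character, given by the compact union of
  circles and the small arc. Each circle is the image of a homomorphism from the reals, so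
  \<open>no_small_subgroups\<close> applies to it.\<close>

lemma dual_dual_discrete:
  "openin (group_topology (dual_group (dual_group Hom_baer_specker)))
     {\<lambda>y\<in>characters Hom_baer_specker. circ 0}"
proof -
  let ?G = "Hom_baer_specker" and ?K = "\<Union>n. range (coordinate_character n)"
  let ?one = "\<lambda>y\<in>characters Hom_baer_specker. circ 0"
  have carr: "carrier (dual_group ?G) = characters ?G"
    and top: "group_topology (dual_group ?G) = compact_open_topology ?G"
    by (simp_all add: dual_group_def)
  have closed: "\<alpha> \<otimes>\<^bsub>dual_group ?G\<^esub> \<beta> \<in> characters ?G"
    if "\<alpha> \<in> characters ?G" "\<beta> \<in> characters ?G" for \<alpha> \<beta>
    using that by (rule characters_mult_closed)
  have "continuous_map (compact_open_topology ?G) (group_topology circle_group) (\<lambda>y. circ 0)"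
    by (simp add: circle_group_def carrier_FactGroup)
  then have "continuous_map (compact_open_topology ?G) (group_topology circle_group) ?one"
    by (rule continuous_map_eq) simp
  then have one: "?one \<in> characters (dual_group ?G)"
    by (auto simp: characters_def [of "dual_group ?G"] hom_def carr top closed carrier_circle mult_circle)
  let ?W = "{\<xi> \<in> characters (dual_group ?G). \<xi> ` ?K \<subseteq> small_arc}"
  have "?W = {?one}"
  proof (intro equalityI subsetI)
    fix \<xi> assume "\<xi> \<in> {?one}"
    then show "\<xi> \<in> ?W"
      using one coordinate_character_in_characters by (auto simp: small_arc_def)
  next
    fix \<xi> assume \<xi>: "\<xi> \<in> ?W"
    then have mult: "\<xi> (\<alpha> \<otimes>\<^bsub>dual_group ?G\<^esub> \<beta>) = \<xi> \<alpha> \<otimes>\<^bsub>circle_group\<^esub> \<xi> \<beta>"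
      if "\<alpha> \<in> characters ?G" "\<beta> \<in> characters ?G" for \<alpha> \<beta>
      using that by (auto simp: characters_def [of "dual_group ?G"] hom_def carr)
    have coord: "\<xi> (coordinate_character n t) = circ 0" for n t
    proof (rule no_small_subgroups [of "\<lambda>t. \<xi> (coordinate_character n t)"])
      show "\<xi> (coordinate_character n t) \<in> small_arc" for t
        using \<xi> by (auto simp: image_subset_iff)
    qed (simp add: coordinate_character_add mult coordinate_character_in_characters)
    have "\<xi> (finite_character c m) = circ 0" for c m
      by (induction m) (simp_all add: finite_character_0 finite_character_Suc coord mult mult_circle
          finite_character_in_characters coordinate_character_in_characters)
    then have "\<xi> y = circ 0" if "y \<in> characters ?G" for y
      using character_determined_by_finite_characters \<xi> that by blast
    moreover have "\<xi> \<in> extensional (characters ?G)"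
      using \<xi> by (simp add: characters_def [of "dual_group ?G"] carr)
    ultimately have "\<xi> = ?one"
      by (intro extensionalityI [of _ "characters ?G"]) auto
    then show "\<xi> \<in> {?one}" by simp
  qed
  moreover have "openin (compact_open_topology (dual_group ?G)) ?W"
    unfolding compact_open_topology_def [of "dual_group ?G"]
    using compactin_coordinate_characters openin_small_arc
    by (intro topology_generated_by_Basis) (auto simp: top)
  ultimately show ?thesis by (simp add: dual_group_def [of "dual_group ?G"])
qed

theorem corollary3p3:
  shows "\<not> pontryagin_reflexive Hom_baer_specker"
proof
  let ?H = "dual_group (dual_group Hom_baer_specker)"
  assume "pontryagin_reflexive Hom_baer_specker"
  then obtain \<phi> where "homeomorphic_map (group_topology ?H) (group_topology Hom_baer_specker) \<phi>"
    by (auto simp: pontryagin_reflexive_def topologically_isomorphic_def)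
  then have "open_map (group_topology ?H) (group_topology Hom_baer_specker) \<phi>"
    by (rule homeomorphic_imp_open_map)
  \<comment> \<open>A homeomorphism would carry the isolated point of the second dual to an isolated
    point of \<open>Hom_baer_specker\<close>.\<close>
  then have "openin (group_topology Hom_baer_specker) (\<phi> ` {\<lambda>y\<in>characters Hom_baer_specker. circ 0})"
    using dual_dual_discrete unfolding open_map_def by blast
  then show False using singleton_not_open_Hom_baer_specker by simp
qed

end
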